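(* Let $n\ge 1$ be an integer. Suppose that for every integer $s\ge 1$ there exists a complete $s,4n$-useful cycle set. Then for every $k\ge 1$, every cyclic snake $kC_{4n}$ (that is, with any string) has a graceful labelling.
   Context: For integers $x<y$ with $x\ge 0$, $[x,y]$ denotes $\{z\in\mathbb{Z} : x\le z\le y\}$. Graceful labelling: for a graph $G=(V,E)$ with $m$ edges, a map $f:V\to\{0,1,\dots,m\}$ is graceful if $f$ is injective and the induced edge labelling $g(uv)=|f(u)-f(v)|$ is a bijection from $E$ onto $\{1,2,\dots,m\}$. Cyclic snake: $kC_r$ denotes any connected graph with exactly $k$ blocks, each block a cycle $C_r$ of length $r$, whose block-cutpoint graph is a path (so the blocks can be listed $B_1,\dots,B_k$ with $B_i$ and $B_{i+1}$ sharing exactly one vertex, which is the $i$-th cut vertex, and the $k-1$ cut vertices are distinct). For $k\ge 3$ its string is $(d_1,\dots,d_{k-2})$, where $d_i$ is the distance between the $i$-th and $(i+1)$-th cut vertices counted from one end of the snake to the other; for $k\in\{1,2\}$ there is no string. Useful cycles: let $t$ be even and $s$ a positive integer. (i) For even $d$, an $s,t$-useful cycle with even distance $d$ is a cycle of length $t$ whose vertices are given distinct labels from $[0,\frac t2-1]\cup[st-\frac t2,st]$ such that the set of induced edge labels (absolute differences of end labels) is exactly $[st-t+1,st]$, and the vertex labelled $0$ and a vertex labelled $\frac t2-1$ are at distance $d$ in the cycle. (ii) For odd $d$, an $s,t$-odd useful cycle with odd distance $d$ is a cycle of length $t$ whose vertices are given distinct labels from $[0,\frac t2]\cup[st-\frac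 t2+1,st]$ such that the set of induced edge labels is exactly $[st-t+1,st]$, and the vertex labelled $0$ and a vertex labelled $st-\frac t2+1$ are at distance $d$ in the cycle. A complete $s,t$-useful cycle set is a set of useful cycles of types (i) and (ii), for this $s$ and $t$, whose distances $d$ together form the set $\{1,2,\dots,\frac t2\}$. *)

theory Defs
  imports Main
begin

text \<open>Undirected simple graphs; an edge is a two-element set of vertices.\<close>

datatype 'a ugraph = UGraph (verts: "'a set") (edges: "'a set set")

definition simple_graph :: "'a ugraph \<Rightarrow> bool" where
  "simple_graph G \<longleftrightarrow> finite (verts G) \<and>
     (\<forall>e\<in>edges G. \<exists>u\<in>verts G. \<exists>v\<in>verts G. u \<noteq> v \<and> e = {u, v})"

definition subgraph :: "'a ugraph \<Rightarrow> 'a ugraph \<Rightarrow> bool" where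
  "subgraph H G \<longleftrightarrow> simple_graph H \<and> verts H \<subseteq> verts G \<and> edges H \<subseteq> edges G"

definition adj_rel :: "'a ugraph \<Rightarrow> ('a \<times> 'a) set" where
  "adj_rel G = {(u, v). {u, v} \<in> edges G}"

definition connected_graph :: "'a ugraph \<Rightarrow> bool" where
  "connected_graph G \<longleftrightarrow> verts G \<noteq> {} \<and>
     (\<forall>u\<in>verts G. \<forall>v\<in>verts G. (u, v) \<in> (adj_rel G)\<^sup>*)"

text \<open>The least length of a walk; only meaningful if \<open>u\<close> and \<open>v\<close> are in the same component.\<close>

definition graph_dist :: "'a ugraph \<Rightarrow> 'a \<Rightarrow> 'a \<Rightarrow> nat" where
  "graph_dist G u v = (LEAST l. (u, v) \<in> adj_rel G ^^ l)"

definition graph_iso :: "'a ugraph \<Rightarrow> 'b ugraph \<Rightarrow> bool" where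
  "graph_iso G H \<longleftrightarrow>
     (\<exists>\<phi>. bij_betw \<phi> (verts G) (verts H) \<and> edges H = (\<lambda>e. \<phi> ` e) ` edges G)"

definition path_graph :: "nat \<Rightarrow> nat ugraph" where
  "path_graph p = UGraph {..<p} {{i, i + 1} | i. i + 1 < p}"

definition cycle_graph :: "nat \<Rightarrow> nat ugraph" where
  "cycle_graph r = UGraph {..<r} {{i, (i + 1) mod r} | i. i < r}"

definition is_path :: "'a ugraph \<Rightarrow> bool" where
  "is_path G \<longleftrightarrow> simple_graph G \<and> (\<exists>p\<ge>1. graph_iso G (path_graph p))"

definition is_cycle :: "nat \<Rightarrow> 'a ugraph \<Rightarrow> bool" where
  "is_cycle r G \<longleftrightarrow> simple_graph G \<and> 3 \<le> r \<and> graph_iso G (cycle_graph r)"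

definition delete_vertex :: "'a ugraph \<Rightarrow> 'a \<Rightarrow> 'a ugraph" where
  "delete_vertex G v = UGraph (verts G - {v}) {e \<in> edges G. v \<notin> e}"

text \<open>Deleting \<open>v\<close> separates two vertices lying in the same component of \<open>G\<close>.\<close>

definition cut_vertex :: "'a ugraph \<Rightarrow> 'a \<Rightarrow> bool" where
  "cut_vertex G v \<longleftrightarrow> v \<in> verts G \<and>
     (\<exists>u\<in>verts G - {v}. \<exists>w\<in>verts G - {v}.
        (u, w) \<in> (adj_rel G)\<^sup>* \<and> (u, w) \<notin> (adj_rel (delete_vertex G v))\<^sup>*)"

text \<open>Blocks are the maximal connected subgraphs without a cut vertex of their own (they may contain cut vertices of \<open>G\<close>).\<close>

definition nonseparable :: "'a ugraph \<Rightarrow> bool" where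
  "nonseparable H \<longleftrightarrow> connected_graph H \<and> (\<forall>v. \<not> cut_vertex H v)"

definition is_block :: "'a ugraph \<Rightarrow> 'a ugraph \<Rightarrow> bool" where
  "is_block G B \<longleftrightarrow> subgraph B G \<and> nonseparable B \<and>
     (\<forall>H. subgraph H G \<and> nonseparable H \<and> subgraph B H \<longrightarrow> H = B)"

definition block_cutpoint_graph :: "'a ugraph \<Rightarrow> ('a ugraph + 'a) ugraph" where
  "block_cutpoint_graph G =
     UGraph (Inl ` {B. is_block G B} \<union> Inr ` {v. cut_vertex G v})
       {{Inl B, Inr v} | B v. is_block G B \<and> cut_vertex G v \<and> v \<in> verts B}"

text \<open>\<open>cyclic_snake k r G\<close> says that \<open>G\<close> is a \<open>kC\<^sub>r\<close>; its string is unrestricted.\<close>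

definition cyclic_snake :: "nat \<Rightarrow> nat \<Rightarrow> 'a ugraph \<Rightarrow> bool" where
  "cyclic_snake k r G \<longleftrightarrow> simple_graph G \<and> connected_graph G \<and>
     card {B. is_block G B} = k \<and> (\<forall>B. is_block G B \<longrightarrow> is_cycle r B) \<and>
     is_path (block_cutpoint_graph G)"

text \<open>Labels are integers, so that differences and interval bounds do not truncate.\<close>

definition graceful_labelling :: "'a ugraph \<Rightarrow> ('a \<Rightarrow> int) \<Rightarrow> bool" where
  "graceful_labelling G f \<longleftrightarrow>
     f ` verts G \<subseteq> {0..int (card (edges G))} \<and> inj_on f (verts G) \<and>
     (\<exists>g. (\<forall>u v. {u, v} \<in> edges G \<longrightarrow> g {u, v} = \<bar>f u - f v\<bar>) \<and>
          bij_betw g (edges G) {1..int (card (edges G))})"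

definition induced_edge_labels :: "'a ugraph \<Rightarrow> ('a \<Rightarrow> int) \<Rightarrow> int set" where
  "induced_edge_labels G f = {\<bar>f u - f v\<bar> | u v. {u, v} \<in> edges G}"

definition even_useful_cycle ::
  "nat \<Rightarrow> nat \<Rightarrow> 'a ugraph \<Rightarrow> ('a \<Rightarrow> int) \<Rightarrow> nat \<Rightarrow> bool" where
  "even_useful_cycle s t C f d \<longleftrightarrow>
     even t \<and> s \<ge> 1 \<and> even d \<and> is_cycle t C \<and> inj_on f (verts C) \<and>
     f ` verts C \<subseteq> {0..int t div 2 - 1} \<union> {int s * int t - int t div 2..int s * int t} \<and>
     induced_edge_labels C f = {int s * int t - int t + 1..int s * int t} \<and>
     (\<exists>u\<in>verts C. \<exists>v\<in>verts C. f u = 0 \<and> f v = int t div 2 - 1 \<and> graph_dist C u v = d)"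

definition odd_useful_cycle ::
  "nat \<Rightarrow> nat \<Rightarrow> 'a ugraph \<Rightarrow> ('a \<Rightarrow> int) \<Rightarrow> nat \<Rightarrow> bool" where
  "odd_useful_cycle s t C f d \<longleftrightarrow>
     even t \<and> s \<ge> 1 \<and> odd d \<and> is_cycle t C \<and> inj_on f (verts C) \<and>
     f ` verts C \<subseteq> {0..int t div 2} \<union> {int s * int t - int t div 2 + 1..int s * int t} \<and>
     induced_edge_labels C f = {int s * int t - int t + 1..int s * int t} \<and>
     (\<exists>u\<in>verts C. \<exists>v\<in>verts C. f u = 0 \<and> f v = int s * int t - int t div 2 + 1 \<and>
        graph_dist C u v = d)"

text \<open>
  An element of the set is a cycle with its labelling and the distance for which it is useful
  (the same labelled cycle may be useful both with an even and with an odd distance).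
\<close>

definition complete_useful_cycle_set ::
  "nat \<Rightarrow> nat \<Rightarrow> ('a ugraph \<times> ('a \<Rightarrow> int) \<times> nat) set \<Rightarrow> bool" where
  "complete_useful_cycle_set s t U \<longleftrightarrow>
     (\<forall>(C, f, d)\<in>U. even_useful_cycle s t C f d \<or> odd_useful_cycle s t C f d) \<and>
     {d. \<exists>C f. (C, f, d) \<in> U} = {1..t div 2}"

end

theory Submission
  imports Defs
begin

text \<open>
  A snake can be labelled one block at a time. Write \<open>t\<close> for the block length and suppose that the
  part of the snake behind the first block \<open>B\<close> has \<open>k\<close> blocks and already carries labels in
  \<open>[0, kt]\<close> with edge labels \<open>[1, kt]\<close> and with label \<open>0\<close> on the cut vertex \<open>c\<close> joining it to \<open>B\<close>.
  Let \<open>v\<close> be a vertex of \<open>B\<close> other than \<open>c\<close>, at distance \<open>d\<close> from \<open>c\<close> in \<open>B\<close>. A useful cycle with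
  parameter \<open>s = k + 1\<close> and distance \<open>d\<close> labels \<open>B\<close> so that \<open>v\<close> receives \<open>0\<close>, the edge labels are
  \<open>[kt + 1, kt + t]\<close>, and the vertex labels avoid a window of consecutive integers between small and
  large ones: they lie in \<open>[0, a] \<union> [kt + a + 1, kt + t]\<close>, where \<open>a = t/2 - 1\<close> for even and
  \<open>a = t/2\<close> for odd \<open>d\<close>. The label of \<open>c\<close> is one of the two borders \<open>a\<close> and \<open>kt + a + 1\<close> of the window.
  The labels of the rest of the snake fit into the window together with that border: add \<open>a\<close> to them
  if \<open>c\<close> carries \<open>a\<close>, and subtract them from \<open>kt + a + 1\<close> otherwise. Neither operation changes an edge
  label, so the result is a labelling of the longer snake with \<open>0\<close> on \<open>v\<close>, and the process
  continues (\<open>rooted_snake_labelling\<close>). No distance other than those in \<open>[1, t/2]\<close> can occur in a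
  cycle of length \<open>t\<close>, so a complete useful cycle set is all that is needed, whatever the string.

  Two things remain. A useful cycle has to be carried over to a given block with prescribed images
  of two vertices; this is possible because two pairs of vertices at the same distance in cycles of
  the same length correspond under some isomorphism (\<open>useful_block_labelling\<close>). And the snake,
  given through its block-cutpoint graph, has to be taken apart into cycles attached one after the
  other (\<open>cyclic_snake_rooted\<close>). The fact behind that is that a vertex in two different blocks
  is a cut vertex (\<open>shared_vertex_is_cut\<close>): along the block-cutpoint path it then
  lies between these two blocks, so only neighbouring blocks meet, and in a single vertex.
\<close>

section \<open>Coordinates on a cycle\<close>

text \<open>The vertices of a cycle are indexed by all integers, periodically with period \<open>t\<close>. Rotations and
reflections of the cycle become the substitutions \<open>i + a\<close> and \<open>- i\<close>, with no reduction modulo \<open>t\<close>.\<close>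

definition winds :: "nat \<Rightarrow> 'a ugraph \<Rightarrow> (int \<Rightarrow> 'a) \<Rightarrow> bool" where
  "winds t C q \<longleftrightarrow> range q = verts C \<and> (\<forall>i j. q i = q j \<longleftrightarrow> i mod int t = j mod int t) \<and>
     edges C = {{q i, q (i + 1)} | i. True}"

lemma winds_shift:
  assumes "winds t C q" shows "winds t C (\<lambda>i. q (i + a))"
proof -
  have "range (\<lambda>i. q (i + a)) = range q"
    using image_image[of q "\<lambda>i. i + a" UNIV] by simp
  moreover have "{{q (i + a), q (i + 1 + a)} | i. True} = {{q i, q (i + 1)} | i. True}" (is "?L = ?R")
  proof
    show "?L \<subseteq> ?R"
      by (auto simp: algebra_simps)
    show "?R \<subseteq> ?L"
    proof
      fix e assume "e \<in> ?R"
      then obtain i where "e = {q i, q (i + 1)}" by blast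
      then have "e = {q ((i - a) + a), q ((i - a) + 1 + a)}" by (simp add: algebra_simps)
      then show "e \<in> ?L" by blast
    qed
  qed
  moreover have "(i + a) mod int t = (j + a) mod int t \<longleftrightarrow> i mod int t = j mod int t" for i j
    by (simp add: mod_eq_dvd_iff)
  ultimately show ?thesis using assms unfolding winds_def by simp
qed

lemma winds_reflect:
  assumes "winds t C q" shows "winds t C (\<lambda>i. q (- i))"
proof -
  have "range (\<lambda>i. q (- i)) = range q"
    using image_image[of q uminus UNIV] by simp
  moreover have "{{q (- i), q (- (i + 1))} | i. True} = {{q i, q (i + 1)} | i. True}" (is "?L = ?R")
  proof
    show "?L \<subseteq> ?R"
    proof
      fix e assume "e \<in> ?L"
      then obtain i where "e = {q (- i), q (- (i + 1))}" by blast
      then have "e = {q (- i - 1), q ((- i - 1) + 1)}" by (simp add: insert_commute)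
      then show "e \<in> ?R" by blast
    qed
    show "?R \<subseteq> ?L"
    proof
      fix e assume "e \<in> ?R"
      then obtain i where "e = {q i, q (i + 1)}" by blast
      then have "e = {q (- (- i - 1)), q (- ((- i - 1) + 1))}"
        by (simp add: insert_commute add.commute)
      then show "e \<in> ?L" by blast
    qed
  qed
  moreover have "(- i) mod int t = (- j) mod int t \<longleftrightarrow> i mod int t = j mod int t" for i j
    by (simp add: mod_eq_dvd_iff dvd_diff_commute)
  ultimately show ?thesis using assms unfolding winds_def by simp
qed

lemma cycle_winds:
  assumes "is_cycle t C" shows "\<exists>q. winds t C q"
proof -
  from assms obtain \<phi> where t: "3 \<le> t" and S: "simple_graph C"
    and bij: "bij_betw \<phi> (verts C) {..<t}"
    and E: "{{i, (i + 1) mod t} | i. i < t} = (\<lambda>e. \<phi> ` e) ` edges C"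
    unfolding is_cycle_def graph_iso_def cycle_graph_def by auto
  define \<psi> where "\<psi> = inv_into (verts C) \<phi>"
  have bij': "bij_betw \<psi> {..<t} (verts C)"
    unfolding \<psi>_def by (rule bij_betw_inv_into[OF bij])
  have \<psi>\<phi>: "\<psi> (\<phi> x) = x" if "x \<in> verts C" for x
    unfolding \<psi>_def using bij that by (simp add: bij_betw_inv_into_left)
  define q where "q i = \<psi> (nat (i mod int t))" for i
  have lt: "nat (i mod int t) < t" for i using t
    by (simp add: nat_less_iff)
  have "range q = verts C"
  proof
    show "range q \<subseteq> verts C" unfolding q_def using bij' lt by (auto simp: bij_betw_def)
    show "verts C \<subseteq> range q"
    proof
      fix x assume "x \<in> verts C"
      then obtain i where i: "i < t" "x = \<psi> i" using bij' by (auto simp: bij_betw_def)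
      then have "x = q (int i)" unfolding q_def by simp
      then show "x \<in> range q" by simp
    qed
  qed
  moreover have "q i = q j \<longleftrightarrow> i mod int t = j mod int t" for i j
  proof
    assume "q i = q j"
    then have "nat (i mod int t) = nat (j mod int t)"
      unfolding q_def using bij' lt by (auto simp: bij_betw_def inj_on_def)
    then show "i mod int t = j mod int t" using t by (simp add: eq_nat_nat_iff)
  qed (simp add: q_def)
  moreover have "edges C = {{q i, q (i + 1)} | i. True}"
  proof -
    have inv: "\<psi> ` \<phi> ` e = e" if "e \<in> edges C" for e
    proof -
      have "e \<subseteq> verts C" using S that unfolding simple_graph_def by auto
      then show ?thesis using \<psi>\<phi> by (force simp: image_image)
    qed
    have "edges C = (\<lambda>e. \<psi> ` e) ` (\<lambda>e. \<phi> ` e) ` edges C"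
      using inv by (force simp: image_image)
    also have "\<dots> = {{\<psi> i, \<psi> ((i + 1) mod t)} | i. i < t}"
      unfolding E[symmetric] by (simp add: setcompr_eq_image image_image)
    also have "\<dots> = {{q i, q (i + 1)} | i. True}"
    proof -
      have q1: "q (i + 1) = \<psi> ((nat (i mod int t) + 1) mod t)" for i
      proof -
        have "int ((nat (i mod int t) + 1) mod t) = (i + 1) mod int t"
          using t by (simp add: zmod_int mod_simps add.commute)
        then show ?thesis unfolding q_def by (metis nat_int)
      qed
      have "{{\<psi> i, \<psi> ((i + 1) mod t)} | i. i < t} \<subseteq> {{q i, q (i + 1)} | i. True}"
      proof
        fix e assume "e \<in> {{\<psi> i, \<psi> ((i + 1) mod t)} | i. i < t}"
        then obtain i where i: "i < t" "e = {\<psi> i, \<psi> ((i + 1) mod t)}" by blast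
        then have "e = {q (int i), q (int i + 1)}" unfolding q1 by (simp add: q_def)
        then show "e \<in> {{q i, q (i + 1)} | i. True}" by blast
      qed
      moreover have "{{q i, q (i + 1)} | i. True} \<subseteq> {{\<psi> i, \<psi> ((i + 1) mod t)} | i. i < t}"
        unfolding q1 using lt by (auto simp: q_def)
      ultimately show ?thesis by blast
    qed
    finally show ?thesis .
  qed
  ultimately show ?thesis unfolding winds_def by blast
qed

text \<open>A walk of length \<open>l\<close> from index \<open>0\<close> only reaches vertices with some index in \<open>[-l, l]\<close>. For
\<open>l < e \<le> t/2\<close> such an index differs from \<open>e\<close> by less than \<open>t\<close>, hence is not congruent to it.\<close>

lemma winds_dist:
  assumes q: "winds t C q" and e: "e \<le> t div 2"
  shows "graph_dist C (q 0) (q (int e)) = e"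
  unfolding graph_dist_def
proof (rule Least_equality)
  have E: "edges C = {{q i, q (i + 1)} | i. True}"
    and eq: "\<And>i j. q i = q j \<longleftrightarrow> i mod int t = j mod int t"
    using q unfolding winds_def by auto
  show "(q 0, q (int e)) \<in> adj_rel C ^^ e"
  proof (induction e)
    case (Suc e)
    have "(q (int e), q (int (Suc e))) \<in> adj_rel C"
      unfolding adj_rel_def E by (auto simp: add.commute)
    then show ?case using Suc by auto
  qed simp
  have step: "\<exists>j. \<bar>j\<bar> \<le> int l \<and> x = q j" if "(q 0, x) \<in> adj_rel C ^^ l" for l x
    using that
  proof (induction l arbitrary: x)
    case 0
    then have "\<bar>0\<bar> \<le> int 0 \<and> x = q 0" by simp
    then show ?case by blast
  next
    case (Suc l)
    then obtain y where "(q 0, y) \<in> adj_rel C ^^ l" and yx: "(y, x) \<in> adj_rel C" by auto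
    with Suc.IH obtain j where j: "\<bar>j\<bar> \<le> int l" "y = q j" by blast
    from yx j obtain i where "{q j, x} = {q i, q (i + 1)}"
      unfolding adj_rel_def E by auto
    then consider "q j = q i" "x = q (i + 1)" | "q j = q (i + 1)" "x = q i"
      by (auto simp: doubleton_eq_iff)
    then show ?case
    proof cases
      case 1
      then have "x = q (j + 1)" unfolding eq by (metis eq mod_add_cong)
      then show ?thesis using j by (intro exI[of _ "j + 1"]) auto
    next
      case 2
      then have "(j - 1) mod int t = (i + 1 - 1) mod int t" by (metis eq mod_diff_cong)
      then have "x = q (j - 1)" using 2 eq by simp
      then show ?thesis using j by (intro exI[of _ "j - 1"]) auto
    qed
  qed
  show "e \<le> l" if "(q 0, q (int e)) \<in> adj_rel C ^^ l" for l
  proof (rule ccontr)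
    assume "\<not> e \<le> l"
    with step[OF that] obtain j where j: "\<bar>j\<bar> < int e" "q (int e) = q j" by force
    then have "int t dvd int e - j" by (simp add: eq mod_eq_dvd_iff)
    moreover have "0 < int e - j" "int e - j < int t" using j e by linarith+
    ultimately show False using zdvd_imp_le by fastforce
  qed
qed

text \<open>Coordinates adapted to two vertices: rotate the first one to index \<open>0\<close>, and reflect if the
other one then lies in the far half of the cycle.\<close>

lemma winds_between:
  assumes "is_cycle t C" "u \<in> verts C" "w \<in> verts C"
  obtains q e where "winds t C q" "e \<le> t div 2" "q 0 = u" "q (int e) = w"
proof -
  obtain q0 where q0: "winds t C q0" using cycle_winds[OF assms(1)] by blast
  then have "u \<in> range q0" using assms(2) unfolding winds_def by simp
  then obtain a where a: "u = q0 a" by blast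
  define q where "q = (\<lambda>i. q0 (i + a))"
  have q: "winds t C q" unfolding q_def by (rule winds_shift[OF q0])
  have qu: "q 0 = u" by (simp add: q_def a)
  have t: "t > 0" using assms(1) by (simp add: is_cycle_def)
  have "w \<in> range q" using assms(3) q unfolding winds_def by simp
  then obtain b where "w = q b" by blast
  moreover define c where "c = b mod int t"
  ultimately have c: "w = q c" "0 \<le> c" "c < int t" using q t unfolding winds_def by auto
  show thesis
  proof (cases "c \<le> int (t div 2)")
    case True
    then show thesis using that[of q "nat c"] q qu c by simp
  next
    case False
    have "(c - int t) mod int t = c mod int t" by simp
    then have "q (c - int t) = w" using q c unfolding winds_def by blast
    then show thesis
      using that[OF winds_reflect[OF q], of "nat (int t - c)"] qu c False by simp
  qed
qed

lemma cycle_two_vertices: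
  assumes "is_cycle t C"
  obtains u v where "u \<in> verts C" "v \<in> verts C" "u \<noteq> v"
proof -
  obtain q where q: "winds t C q" using cycle_winds[OF assms] by blast
  have "(0 :: int) mod int t \<noteq> 1 mod int t" using assms unfolding is_cycle_def by simp
  then have "q 0 \<noteq> q 1" using q unfolding winds_def by blast
  moreover have "q 0 \<in> verts C" "q 1 \<in> verts C" using q unfolding winds_def by auto
  ultimately show thesis using that by blast
qed

lemma winds_card_edges_le:
  assumes "winds t C q" "t > 0"
  shows "finite (edges C)" "card (edges C) \<le> t"
proof -
  have "edges C \<subseteq> (\<lambda>i. {q i, q (i + 1)}) ` {0..<int t}"
  proof
    fix e assume "e \<in> edges C"
    then obtain i where e: "e = {q i, q (i + 1)}" using assms(1) unfolding winds_def by auto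
    have "q (i mod int t) = q i" "q (i mod int t + 1) = q (i + 1)"
      using assms(1) unfolding winds_def by (simp_all add: mod_simps)
    then have "e = {q (i mod int t), q (i mod int t + 1)}" using e by simp
    moreover have "i mod int t \<in> {0..<int t}" using assms(2) by simp
    ultimately show "e \<in> (\<lambda>i. {q i, q (i + 1)}) ` {0..<int t}" by blast
  qed
  then show "finite (edges C)" "card (edges C) \<le> t"
    using surj_card_le[of "{0..<int t}" "edges C"] by (auto intro: finite_subset)
qed

lemma winds_induced_edge_labels:
  assumes "winds t C q"
  shows "induced_edge_labels C f = range (\<lambda>i. \<bar>f (q i) - f (q (i + 1))\<bar>)"
proof
  show "induced_edge_labels C f \<subseteq> range (\<lambda>i. \<bar>f (q i) - f (q (i + 1))\<bar>)"
  proof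
    fix l assume "l \<in> induced_edge_labels C f"
    then obtain x y where l: "l = \<bar>f x - f y\<bar>" "{x, y} \<in> edges C"
      unfolding induced_edge_labels_def by blast
    then obtain i where "{x, y} = {q i, q (i + 1)}" using assms unfolding winds_def by auto
    then have "l = \<bar>f (q i) - f (q (i + 1))\<bar>" using l(1) by (auto simp: doubleton_eq_iff)
    then show "l \<in> range (\<lambda>i. \<bar>f (q i) - f (q (i + 1))\<bar>)" by blast
  qed
  show "range (\<lambda>i. \<bar>f (q i) - f (q (i + 1))\<bar>) \<subseteq> induced_edge_labels C f"
  proof
    fix l assume "l \<in> range (\<lambda>i. \<bar>f (q i) - f (q (i + 1))\<bar>)"
    then obtain i where "l = \<bar>f (q i) - f (q (i + 1))\<bar>" by blast
    moreover have "{q i, q (i + 1)} \<in> edges C" using assms unfolding winds_def by auto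
    ultimately show "l \<in> induced_edge_labels C f" unfolding induced_edge_labels_def by blast
  qed
qed

text \<open>Matching equal indices of two windings is an isomorphism of the two cycles; the labels are moved
along it.\<close>

lemma winds_transport:
  assumes B: "winds t B q" and C: "winds t C r"
  obtains h where "\<And>i. h (q i) = f (r i)" "h ` verts B = f ` verts C"
    "inj_on f (verts C) \<Longrightarrow> inj_on h (verts B)"
    "induced_edge_labels B h = induced_edge_labels C f"
proof -
  define h where "h x = f (r (SOME i. q i = x))" for x
  have h: "h (q i) = f (r i)" for i
  proof -
    have "q (SOME j. q j = q i) = q i" by (rule someI) simp
    then have "r (SOME j. q j = q i) = r i" using B C unfolding winds_def by metis
    then show ?thesis unfolding h_def by simp
  qed
  have VB: "verts B = range q" and VC: "verts C = range r" 
    using B C unfolding winds_def by auto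
  show thesis
  proof
    show "h (q i) = f (r i)" for i by (rule h)
    show "h ` verts B = f ` verts C" unfolding VB VC by (auto simp: image_image h)
    show "inj_on h (verts B)" if "inj_on f (verts C)"
    proof (rule inj_onI)
      fix x y assume "x \<in> verts B" "y \<in> verts B" and xy: "h x = h y"
      then obtain i j where ij: "x = q i" "y = q j" unfolding VB by auto
      then have "r i = r j" using xy that unfolding VC h by (auto simp: h inj_on_def)
      then show "x = y" using B C ij unfolding winds_def by metis
    qed
    show "induced_edge_labels B h = induced_edge_labels C f"
      unfolding winds_induced_edge_labels[OF B] winds_induced_edge_labels[OF C] h ..
  qed
qed

text \<open>The even and the odd kind of useful cycle in one form, with \<open>a = t/2 - 1\<close> and \<open>a = t/2\<close>
respectively: the labels leave out a window of \<open>(s - 1) t\<close> integers, and \<open>c\<close> sits at its lower or its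
upper border.\<close>

lemma useful_block_labelling:
  assumes U: "complete_useful_cycle_set s t (U :: (nat ugraph \<times> (nat \<Rightarrow> int) \<times> nat) set)"
    and B: "is_cycle t B" and vc: "v \<in> verts B" "c \<in> verts B" "v \<noteq> c"
  obtains h a where "inj_on h (verts B)" "h v = 0" "0 \<le> a" "a \<le> int t"
    "h ` verts B \<subseteq> {0..a} \<union> {(int s - 1) * int t + a + 1..int s * int t}"
    "induced_edge_labels B h = {(int s - 1) * int t + 1..int s * int t}"
    "h c = a \<or> h c = (int s - 1) * int t + a + 1"
proof -
  note result = that
  obtain q e where q: "winds t B q" "e \<le> t div 2" "q 0 = v" "q (int e) = c"
    using winds_between[OF B vc(1,2)] .
  \<comment> \<open>The index of \<open>c\<close> is its distance from \<open>v\<close>, which selects the useful cycle to be used.\<close>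
  have "e \<in> {1..t div 2}" using q vc(3) by (cases e) auto
  then obtain C f where mem: "(C, f, e) \<in> U" using U unfolding complete_useful_cycle_set_def by blast
  have C_cases: thesis
    if C: "is_cycle t C" "u \<in> verts C" "w \<in> verts C" "graph_dist C u w = e"
      and f: "inj_on f (verts C)" "f u = 0" "0 \<le> a" "a \<le> int t"
      "f ` verts C \<subseteq> {0..a} \<union> {(int s - 1) * int t + a + 1..int s * int t}"
      "induced_edge_labels C f = {(int s - 1) * int t + 1..int s * int t}"
      "f w = a \<or> f w = (int s - 1) * int t + a + 1" for u w a
  proof -
    obtain r e' where r: "winds t C r" "e' \<le> t div 2" "r 0 = u" "r (int e') = w"
      using winds_between[OF C(1-3)] .
    have "e' = e" using winds_dist[OF r(1,2)] r C(4) by simp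
    obtain h where h: "\<And>i. h (q i) = f (r i)" "h ` verts B = f ` verts C"
      "inj_on f (verts C) \<Longrightarrow> inj_on h (verts B)"
      "induced_edge_labels B h = induced_edge_labels C f"
      using winds_transport[OF q(1) r(1)] by metis
    have hv: "h v = f u" using h(1)[of 0] q(3) r(3) by simp
    have hc: "h c = f w" using h(1)[of "int e"] q(4) r(4) \<open>e' = e\<close> by simp
    show thesis
      by (rule result[of h a]; (unfold hv hc h(2,4))?; (rule h(3) f)+)
  qed
  from mem U have "even_useful_cycle s t C f e \<or> odd_useful_cycle s t C f e"
    unfolding complete_useful_cycle_set_def by blast
  then show thesis
  proof
    assume ev: "even_useful_cycle s t C f e"
    then have t: "2 * (int t div 2) = int t" "t \<ge> 3"
      unfolding even_useful_cycle_def is_cycle_def by auto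
    have eq: "(int s - 1) * int t = int s * int t - int t"
      "(int s - 1) * int t + (int t div 2 - 1) + 1 = int s * int t - int t div 2"
      using t(1) by (simp_all add: left_diff_distrib)
    obtain u w where "u \<in> verts C" "w \<in> verts C" "graph_dist C u w = e" "f u = 0"
      "f w = int t div 2 - 1"
      using ev unfolding even_useful_cycle_def by blast
    then show thesis
      using ev t(2) unfolding even_useful_cycle_def
      by (intro C_cases[of u w "int t div 2 - 1", unfolded eq(2), unfolded eq(1)]) simp_all
  next
    assume od: "odd_useful_cycle s t C f e"
    then have t: "2 * (int t div 2) = int t" "t \<ge> 3"
      unfolding odd_useful_cycle_def is_cycle_def by auto
    have eq: "(int s - 1) * int t = int s * int t - int t"
      "(int s - 1) * int t + int t div 2 + 1 = int s * int t - int t div 2 + 1"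
      using t(1) by (simp_all add: left_diff_distrib)
    obtain u w where "u \<in> verts C" "w \<in> verts C" "graph_dist C u w = e" "f u = 0"
      "f w = int s * int t - int t div 2 + 1"
      using od unfolding odd_useful_cycle_def by blast
    then show thesis
      using od t(2) unfolding odd_useful_cycle_def
      by (intro C_cases[of u w "int t div 2", unfolded eq(2), unfolded eq(1)]) simp_all
  qed
qed

section \<open>Labelling a rooted snake\<close>

definition graph_union :: "'a ugraph \<Rightarrow> 'a ugraph \<Rightarrow> 'a ugraph" where
  "graph_union G H = UGraph (verts G \<union> verts H) (edges G \<union> edges H)"

text \<open>A snake of \<open>k\<close> cycles grown from its last block to its first. The root \<open>v\<close> is the vertex of the
first block at which the next cycle may be attached; it differs from the cut vertex \<open>c\<close> already used
in that block.\<close>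

inductive rooted_snake :: "nat \<Rightarrow> nat \<Rightarrow> 'a \<Rightarrow> 'a ugraph \<Rightarrow> bool" for t where
  single: "is_cycle t B \<Longrightarrow> v \<in> verts B \<Longrightarrow> rooted_snake t 1 v B"
| attach: "is_cycle t B \<Longrightarrow> v \<in> verts B \<Longrightarrow> c \<in> verts B \<Longrightarrow> v \<noteq> c \<Longrightarrow>
    rooted_snake t k c G \<Longrightarrow> verts B \<inter> verts G = {c} \<Longrightarrow>
    rooted_snake t (Suc k) v (graph_union B G)"

lemma simple_graph_union:
  assumes "simple_graph G" "simple_graph H" shows "simple_graph (graph_union G H)"
  unfolding simple_graph_def
proof (intro conjI ballI)
  show "finite (verts (graph_union G H))"
    using assms unfolding simple_graph_def graph_union_def by simp
  fix e assume "e \<in> edges (graph_union G H)"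
  then have "e \<in> edges G \<or> e \<in> edges H" unfolding graph_union_def by simp
  then obtain u v where "u \<in> verts G \<and> v \<in> verts G \<or> u \<in> verts H \<and> v \<in> verts H"
    and uv: "u \<noteq> v" "e = {u, v}"
    using assms unfolding simple_graph_def by meson
  then have "u \<in> verts (graph_union G H)" "v \<in> verts (graph_union G H)"
    unfolding graph_union_def by auto
  then show "\<exists>u\<in>verts (graph_union G H). \<exists>v\<in>verts (graph_union G H). u \<noteq> v \<and> e = {u, v}"
    using uv by blast
qed

text \<open>A labelling with \<open>k * t\<close> different edge labels forces at least \<open>k * t\<close> edges, so this bound will
determine their number.\<close>

lemma rooted_snake_edge_bound:
  assumes "rooted_snake t k v G"
  shows "simple_graph G \<and> finite (edges G) \<and> card (edges G) \<le> k * t"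
  using assms
proof induction
  case (single B v)
  obtain q where "winds t B q" using cycle_winds single by blast
  then show ?case using winds_card_edges_le[of t B q] single unfolding is_cycle_def by auto
next
  case (attach B v c k G)
  obtain q where "winds t B q" using cycle_winds attach by blast
  then have "finite (edges B)" "card (edges B) \<le> t"
    using winds_card_edges_le[of t B q] attach unfolding is_cycle_def by auto
  moreover have "card (edges B \<union> edges G) \<le> card (edges B) + card (edges G)" by (rule card_Un_le)
  moreover have "simple_graph (graph_union B G)"
    using attach unfolding is_cycle_def by (intro simple_graph_union) simp_all
  ultimately show ?case using attach unfolding graph_union_def by auto
qed

lemma induced_edge_labels_reflect: "induced_edge_labels G (\<lambda>x. b - f x) = induced_edge_labels G f"
  unfolding induced_edge_labels_def by (auto simp: abs_minus_commute)

lemma induced_edge_labels_shift: "induced_edge_labels G (\<lambda>x. f x + b) = induced_edge_labels G f"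
  unfolding induced_edge_labels_def by auto

lemma induced_edge_labels_cong:
  assumes "simple_graph G" "\<And>x. x \<in> verts G \<Longrightarrow> f x = g x"
  shows "induced_edge_labels G f = induced_edge_labels G g"
proof -
  have "u \<in> verts G \<and> v \<in> verts G" if "{u, v} \<in> edges G" for u v
    using assms(1) that unfolding simple_graph_def by (auto simp: doubleton_eq_iff)
  then have "f u = g u \<and> f v = g v" if "{u, v} \<in> edges G" for u v
    using that assms(2) by blast
  then show ?thesis unfolding induced_edge_labels_def by (metis (no_types, opaque_lifting))
qed

text \<open>If the only common label is that of the common vertex, injectivity is preserved.\<close>

lemma glue_labellings:
  assumes S: "simple_graph B" "simple_graph G" and c: "verts B \<inter> verts G = {c}"
    and hf: "h c = f c" "inj_on h (verts B)" "inj_on f (verts G)"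
    and disj: "h ` verts B \<inter> f ` verts G \<subseteq> {h c}"
  obtains F where "\<And>x. x \<in> verts B \<Longrightarrow> F x = h x" "\<And>x. x \<in> verts G \<Longrightarrow> F x = f x"
    "inj_on F (verts B \<union> verts G)"
    "induced_edge_labels (graph_union B G) F = induced_edge_labels B h \<union> induced_edge_labels G f"
proof -
  define F where "F x = (if x \<in> verts B then h x else f x)" for x
  have F: "F x = h x" if "x \<in> verts B" for x using that by (simp add: F_def)
  have F': "F x = f x" if "x \<in> verts G" for x
    using that c hf(1) unfolding F_def by auto
  have cross: "x = y" if "x \<in> verts B" "y \<in> verts G" "h x = f y" for x y
  proof -
    have "h x \<in> h ` verts B \<inter> f ` verts G" using that by (metis IntI imageI)
    then have "h x = h c" "f y = f c" using disj that(3) hf(1) by auto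
    moreover have "c \<in> verts B" "c \<in> verts G" using c by auto
    ultimately have "x = c" "y = c" using that hf(2,3) by (metis inj_onD)+
    then show ?thesis by simp
  qed
  have "inj_on F (verts B \<union> verts G)"
  proof (rule inj_onI)
    fix x y assume "x \<in> verts B \<union> verts G" "y \<in> verts B \<union> verts G" "F x = F y"
    then show "x = y"
      using F F' cross[of x y] cross[of y x] hf(2,3) by (auto dest: inj_onD)
  qed
  moreover have "induced_edge_labels (graph_union B G) F =
      induced_edge_labels B F \<union> induced_edge_labels G F"
    unfolding induced_edge_labels_def graph_union_def by auto
  ultimately show thesis
    using that[of F] F F' induced_edge_labels_cong[OF S(1), of F h]
      induced_edge_labels_cong[OF S(2), of F f] by simp
qed

text \<open>In the inductive step the labels \<open>[0, m]\<close> of the shorter snake, where \<open>m\<close> is its number of edges,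
are moved into the window left free by the new block, by translation or by reflection, so that the
root \<open>c\<close> of the shorter snake goes to the border of the window that the new block assigns to \<open>c\<close>.\<close>

lemma rooted_snake_labelling:
  assumes "rooted_snake t k v G"
    and U: "\<And>s. s \<ge> 1 \<Longrightarrow>
      \<exists>U :: (nat ugraph \<times> (nat \<Rightarrow> int) \<times> nat) set. complete_useful_cycle_set s t U"
  shows "\<exists>f. f v = 0 \<and> inj_on f (verts G) \<and> f ` verts G \<subseteq> {0..int k * int t} \<and>
    induced_edge_labels G f = {1..int k * int t}"
  using assms(1)
proof induction
  case (single B v)
  obtain c where c: "c \<in> verts B" "v \<noteq> c" using cycle_two_vertices[OF single(1)] by metis
  obtain U :: "(nat ugraph \<times> (nat \<Rightarrow> int) \<times> nat) set" where "complete_useful_cycle_set 1 t U"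
    using U[of 1] by auto
  then obtain h a where h: "inj_on h (verts B)" "h v = 0" "0 \<le> a" "a \<le> int t"
    "h ` verts B \<subseteq> {0..a} \<union> {(int 1 - 1) * int t + a + 1..int 1 * int t}"
    "induced_edge_labels B h = {(int 1 - 1) * int t + 1..int 1 * int t}"
    using useful_block_labelling[OF _ single c] by metis
  have "h ` verts B \<subseteq> {0..int 1 * int t}" using h(3-5) by force
  then show ?case using h by (intro exI[of _ h]) simp
next
  case (attach B v c k G)
  define m where "m = int k * int t"
  obtain f where f: "f c = 0" "inj_on f (verts G)" "f ` verts G \<subseteq> {0..m}"
    "induced_edge_labels G f = {1..m}" using attach.IH unfolding m_def by blast
  have S: "simple_graph B" "simple_graph G"
    using attach.hyps(1) rooted_snake_edge_bound[OF attach.hyps(5)] unfolding is_cycle_def by simp_all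
  obtain U :: "(nat ugraph \<times> (nat \<Rightarrow> int) \<times> nat) set"
    where Uk: "complete_useful_cycle_set (Suc k) t U" using U[of "Suc k"] by auto
  have sizes: "(int (Suc k) - 1) * int t = m" "int (Suc k) * int t = m + int t"
    unfolding m_def by (simp_all add: distrib_right)
  obtain h a where h: "inj_on h (verts B)" "h v = 0" "0 \<le> a" "a \<le> int t"
    "h ` verts B \<subseteq> {0..a} \<union> {m + a + 1..m + int t}"
    "induced_edge_labels B h = {m + 1..m + int t}"
    "h c = a \<or> h c = m + a + 1"
    using useful_block_labelling[OF Uk attach.hyps(1-4)] unfolding sizes .
  have m0: "m \<ge> 0" unfolding m_def by simp
  obtain f' where f': "f' c = h c" "inj_on f' (verts G)" "induced_edge_labels G f' = {1..m}"
    "f' ` verts G \<subseteq> {0..m + int t}" "h ` verts B \<inter> f' ` verts G \<subseteq> {h c}"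
    using h(7)
  proof
    assume a: "h c = a"
    show thesis
    proof (rule that[of "\<lambda>x. f x + a"])
      show "inj_on (\<lambda>x. f x + a) (verts G)" using f(2) by (auto simp: inj_on_def)
      show "(\<lambda>x. f x + a) ` verts G \<subseteq> {0..m + int t}" using f(3) h(3,4) by force
      show "h ` verts B \<inter> (\<lambda>x. f x + a) ` verts G \<subseteq> {h c}" using f(3) h(5) a by force
    qed (simp_all add: f a induced_edge_labels_shift)
  next
    assume a: "h c = m + a + 1"
    \<comment> \<open>The upper border is a label of the block, so it is at most \<open>m + t\<close>, and then so are
      all the reflected labels.\<close>
    have at: "a + 1 \<le> int t" using h(5) a attach.hyps(3) m0 by force
    show thesis
    proof (rule that[of "\<lambda>x. (m + a + 1) - f x"])
      show "inj_on (\<lambda>x. (m + a + 1) - f x) (verts G)" using f(2) by (auto simp: inj_on_def)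
      show "(\<lambda>x. (m + a + 1) - f x) ` verts G \<subseteq> {0..m + int t}" using f(3) h(3) at by force
      show "h ` verts B \<inter> (\<lambda>x. (m + a + 1) - f x) ` verts G \<subseteq> {h c}" using f(3) h(5) a by force
    qed (simp_all add: f a induced_edge_labels_reflect)
  qed
  obtain F where F: "\<And>x. x \<in> verts B \<Longrightarrow> F x = h x" "\<And>x. x \<in> verts G \<Longrightarrow> F x = f' x"
    "inj_on F (verts B \<union> verts G)"
    "induced_edge_labels (graph_union B G) F = induced_edge_labels B h \<union> induced_edge_labels G f'"
    using glue_labellings[OF S attach.hyps(6) f'(1)[symmetric] h(1) f'(2) f'(5)] by blast
  have "h ` verts B \<subseteq> {0..m + int t}" using h(3-5) m0 by force
  then have "F ` (verts B \<union> verts G) \<subseteq> {0..m + int t}" using f'(4) F(1,2) by auto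
  moreover have "induced_edge_labels (graph_union B G) F = {1..m + int t}"
    unfolding F(4) h(6) f'(3) using m0 by auto
  moreover have "F v = 0" using F(1) attach.hyps(2) h(2) by simp
  ultimately show ?case using F(3) unfolding sizes by (intro exI[of _ F]) (simp add: graph_union_def)
qed

text \<open>At most \<open>m\<close> edges carry all \<open>m\<close> labels, so the edge labelling is injective and there are exactly
\<open>m\<close> edges.\<close>

lemma graceful_labelling_by_counting:
  assumes "simple_graph G" "f ` verts G \<subseteq> {0..int m}" "inj_on f (verts G)"
    "finite (edges G)" "card (edges G) \<le> m" "induced_edge_labels G f = {1..int m}"
  shows "graceful_labelling G f"
proof -
  \<comment> \<open>An expression for \<open>\<bar>f u - f v\<bar>\<close> in terms of the edge \<open>{u, v}\<close> alone.\<close>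
  define g where "g e = Max (f ` e) - Min (f ` e)" for e
  have g: "g {u, v} = \<bar>f u - f v\<bar>" for u v unfolding g_def by auto
  have img: "g ` edges G = {1..int m}"
  proof -
    have "\<exists>u v. e = {u, v}" if "e \<in> edges G" for e
      using assms(1) that unfolding simple_graph_def by blast
    then have "g ` edges G = induced_edge_labels G f"
      unfolding induced_edge_labels_def by (force simp: g[symmetric])
    then show ?thesis using assms(6) by simp
  qed
  then have "m \<le> card (edges G)" using card_image_le[OF assms(4), of g] by simp
  then have m: "card (edges G) = m" using assms(5) by simp
  then have "inj_on g (edges G)" using img assms(4) by (intro eq_card_imp_inj_on) auto
  then have "bij_betw g (edges G) {1..int m}" using img by (simp add: bij_betw_def)
  then show ?thesis unfolding graceful_labelling_def m using assms g by blast
qed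

section \<open>Blocks\<close>

lemma adj_rel_sym: "sym (adj_rel G)"
  unfolding adj_rel_def sym_def by (auto simp: insert_commute)

lemma reach_sym: "(x, y) \<in> (adj_rel G)\<^sup>* \<Longrightarrow> (y, x) \<in> (adj_rel G)\<^sup>*"
  using sym_rtrancl[OF adj_rel_sym] by (rule symD)

lemma reach_mono: "(x, y) \<in> (adj_rel G)\<^sup>* \<Longrightarrow> edges G \<subseteq> edges H \<Longrightarrow> (x, y) \<in> (adj_rel H)\<^sup>*"
  by (rule rtrancl_mono[THEN subsetD]) (auto simp: adj_rel_def)

lemma reach_delete_mono:
  "(x, y) \<in> (adj_rel (delete_vertex G z))\<^sup>* \<Longrightarrow> edges G \<subseteq> edges H \<Longrightarrow>
    (x, y) \<in> (adj_rel (delete_vertex H z))\<^sup>*"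
  by (erule reach_mono) (auto simp: delete_vertex_def)

lemma reach_segment:
  assumes "\<And>k. i \<le> k \<Longrightarrow> k < j \<Longrightarrow> {p k, p (Suc k)} \<in> edges K" "i \<le> j"
  shows "(p i, p j) \<in> (adj_rel K)\<^sup>*"
  using assms(2,1)
proof (induction j rule: dec_induct)
  case (step j)
  then have "(p j, p (Suc j)) \<in> adj_rel K" by (simp add: adj_rel_def)
  moreover have "(p i, p j) \<in> (adj_rel K)\<^sup>*" using step by simp
  ultimately show ?case by (rule rtrancl_into_rtrancl[rotated])
qed simp

text \<open>Reachability is symmetric and transitive, so it is enough to connect everything to one root,
which may be chosen anew for each deleted vertex.\<close>

lemma nonseparableI_roots:
  assumes "r \<in> verts H" "\<And>x. x \<in> verts H \<Longrightarrow> (x, r) \<in> (adj_rel H)\<^sup>*"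
    and "\<And>z. z \<in> verts H \<Longrightarrow> \<exists>r. \<forall>x\<in>verts H - {z}. (x, r) \<in> (adj_rel (delete_vertex H z))\<^sup>*"
  shows "nonseparable H"
  unfolding nonseparable_def connected_graph_def cut_vertex_def
  using assms reach_sym rtrancl_trans by (metis empty_iff)

lemma simple_graph_edge_verts:
  assumes "simple_graph G" "{u, v} \<in> edges G" shows "u \<in> verts G" "v \<in> verts G" "u \<noteq> v"
  using assms unfolding simple_graph_def by (auto simp: doubleton_eq_iff)

text \<open>Among the nonseparable subgraphs containing \<open>H\<close>, one with the largest number of vertices plus
edges is maximal.\<close>

lemma nonseparable_in_block:
  assumes G: "simple_graph G" and H: "subgraph H G" "nonseparable H"
  obtains B where "is_block G B" "subgraph H B"
proof -
  define P where "P K \<longleftrightarrow> subgraph K G \<and> nonseparable K \<and> subgraph H K" for K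
  define \<mu> where "\<mu> K = card (verts K) + card (edges K)" for K :: "'a ugraph"
  have fV: "finite (verts G)" using G unfolding simple_graph_def by blast
  have "edges G \<subseteq> Pow (verts G)" using G unfolding simple_graph_def by auto
  then have fE: "finite (edges G)" using fV by (meson finite_Pow_iff finite_subset)
  have "P H" using H unfolding P_def subgraph_def by auto
  moreover have "\<forall>K. P K \<longrightarrow> \<mu> K < Suc (\<mu> G)"
    unfolding P_def \<mu>_def subgraph_def using fV fE by (simp add: add_mono card_mono less_Suc_eq_le)
  ultimately obtain B where B: "P B" "\<And>K. P K \<Longrightarrow> \<mu> K \<le> \<mu> B"
    using ex_has_greatest_nat[of P H \<mu> "Suc (\<mu> G)"] by auto
  have "K = B" if K: "subgraph K G" "nonseparable K" "subgraph B K" for K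
  proof -
    have fK: "finite (verts K)" "finite (edges K)"
      using K(1) fV fE unfolding subgraph_def by (auto intro: finite_subset)
    have sub: "verts B \<subseteq> verts K" "edges B \<subseteq> edges K" using K(3) unfolding subgraph_def by auto
    have "P K" using K B(1) unfolding P_def subgraph_def by auto
    then have "\<mu> K \<le> \<mu> B" by (rule B(2))
    moreover have "card (verts B) \<le> card (verts K)" "card (edges B) \<le> card (edges K)"
      using sub fK by (auto intro: card_mono)
    ultimately have "card (verts B) = card (verts K)" "card (edges B) = card (edges K)"
      unfolding \<mu>_def by auto
    then have "verts B = verts K" "edges B = edges K" using sub fK card_subset_eq by metis+
    then show ?thesis by (simp add: ugraph.expand)
  qed
  then show thesis using that[of B] B(1) unfolding is_block_def P_def by blast
qed

lemma block_subgraph: "is_block G B \<Longrightarrow> subgraph B G"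
  and block_nonseparable: "is_block G B \<Longrightarrow> nonseparable B"
  and block_maximal: "is_block G B \<Longrightarrow> subgraph H G \<Longrightarrow> nonseparable H \<Longrightarrow> subgraph B H \<Longrightarrow> H = B"
  unfolding is_block_def by blast+

lemma vertex_in_block:
  assumes G: "simple_graph G" and "v \<in> verts G"
  obtains B where "is_block G B" "v \<in> verts B"
proof -
  have "nonseparable (UGraph {v} {})"
    unfolding nonseparable_def connected_graph_def cut_vertex_def by auto
  moreover have "subgraph (UGraph {v} {}) G"
    using assms unfolding subgraph_def simple_graph_def by auto
  ultimately obtain B where "is_block G B" "subgraph (UGraph {v} {}) B"
    using nonseparable_in_block[OF G] by blast
  then show thesis using that[of B] unfolding subgraph_def by auto
qed

lemma edge_in_block:
  assumes G: "simple_graph G" and "e \<in> edges G"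
  obtains B where "is_block G B" "e \<in> edges B"
proof -
  obtain u v where e: "u \<in> verts G" "v \<in> verts G" "u \<noteq> v" "e = {u, v}"
    using assms unfolding simple_graph_def by blast
  let ?K = "UGraph {u, v} {e}"
  have "nonseparable ?K"
  proof (rule nonseparableI_roots[of u])
    show "(x, u) \<in> (adj_rel ?K)\<^sup>*" if "x \<in> verts ?K" for x
      using that e by (cases "x = u") (auto simp: adj_rel_def insert_commute)
    show "\<exists>r. \<forall>x\<in>verts ?K - {z}. (x, r) \<in> (adj_rel (delete_vertex ?K z))\<^sup>*"
      if "z \<in> verts ?K" for z
      using that by (intro exI[of _ "if z = u then v else u"]) auto
  qed simp
  moreover have "subgraph ?K G"
    using assms e unfolding subgraph_def simple_graph_def by auto
  ultimately obtain B where "is_block G B" "subgraph ?K B"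
    using nonseparable_in_block[OF G] by blast
  then show thesis using that[of B] unfolding subgraph_def by auto
qed

text \<open>A shortest walk does not repeat a vertex, since the part between two visits could be cut out.\<close>

lemma simple_path_of_reach:
  assumes "(x, y) \<in> R\<^sup>*"
  obtains p :: "nat \<Rightarrow> 'a" and l where "p 0 = x" "p l = y"
    "\<And>i. i < l \<Longrightarrow> (p i, p (Suc i)) \<in> R" "inj_on p {..l}"
proof -
  define l where "l = (LEAST l. (x, y) \<in> R ^^ l)"
  have "\<exists>l. (x, y) \<in> R ^^ l" using assms by (simp add: rtrancl_power)
  then have l: "(x, y) \<in> R ^^ l" unfolding l_def by (rule LeastI_ex)
  then obtain p where p: "p 0 = x" "p l = y" "\<And>i. i < l \<Longrightarrow> (p i, p (Suc i)) \<in> R"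
    by (auto simp: relpow_fun_conv)
  have seg: "(p i, p (i + k)) \<in> R ^^ k" if "i + k \<le> l" for i k
    using that by (induction k) (use p(3) in \<open>auto\<close>)
  have "p i \<noteq> p j" if "i < j" "j \<le> l" for i j
  proof
    assume eq: "p i = p j"
    have "(x, p i) \<in> R ^^ i" using seg[of 0 i] that p(1) by simp
    moreover have "(p i, y) \<in> R ^^ (l - j)" using seg[of j "l - j"] that p(2) eq by simp
    ultimately have "(x, y) \<in> R ^^ (i + (l - j))" by (auto simp: relpow_add)
    then have "l \<le> i + (l - j)" unfolding l_def by (rule Least_le)
    then show False using that by linarith
  qed
  then have "inj_on p {..l}" by (intro linorder_inj_onI) auto
  then show thesis using that p by blast
qed

text \<open>Otherwise a simple path \<open>p\<close> avoiding \<open>v\<close> leads from one block to the other, and the union \<open>H\<close> of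
both blocks and \<open>p\<close> is nonseparable, against maximality. Deleting \<open>v\<close> from \<open>H\<close> leaves two connected
pieces joined by \<open>p\<close>; deleting any other vertex leaves both blocks joined at \<open>v\<close>, and each vertex
remaining on \<open>p\<close> can still follow \<open>p\<close> in at least one direction to its end. The argument also covers
blocks that share several vertices.\<close>

lemma shared_vertex_is_cut:
  assumes G: "simple_graph G" "connected_graph G"
    and B: "is_block G B" "is_block G B'" "B \<noteq> B'" and v: "v \<in> verts B" "v \<in> verts B'"
  shows "cut_vertex G v"
proof (rule ccontr)
  assume ncut: "\<not> cut_vertex G v"
  have sub: "subgraph B G" "subgraph B' G" and ns: "nonseparable B" "nonseparable B'"
    using B block_subgraph block_nonseparable by blast+
  \<comment> \<open>A block consisting of \<open>v\<close> alone would be contained in the other block, so both blocks have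
    a vertex besides \<open>v\<close>.\<close>
  have other: "\<exists>b. b \<in> verts K \<and> b \<noteq> v"
    if K: "is_block G K" "is_block G K'" "K \<noteq> K'" "v \<in> verts K" "v \<in> verts K'" for K K'
  proof (rule ccontr)
    assume "\<not> ?thesis"
    then have V: "verts K = {v}" using K(4) by blast
    have s: "subgraph K G" "subgraph K' G" "nonseparable K'"
      using K(1,2) block_subgraph block_nonseparable by blast+
    have "edges K = {}"
    proof (rule ccontr)
      assume "edges K \<noteq> {}"
      then obtain e where "e \<in> edges K" by blast
      then obtain x y where "x \<in> verts K" "y \<in> verts K" "x \<noteq> y"
        using s(1) unfolding subgraph_def simple_graph_def by meson
      then show False using V by simp
    qed
    then have "subgraph K K'" using s(1) V K(5) unfolding subgraph_def by simp
    then have "K' = K" using block_maximal[OF K(1) s(2,3)] by blast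
    then show False using K(3) by simp
  qed
  obtain b where b: "b \<in> verts B" "b \<noteq> v" using other[OF B v] by blast
  obtain b' where b': "b' \<in> verts B'" "b' \<noteq> v" using other[OF B(2,1) B(3)[symmetric] v(2,1)] by blast
  have "v \<in> verts G" "b \<in> verts G" "b' \<in> verts G"
    using v b b' sub unfolding subgraph_def by auto
  then have "(b, b') \<in> (adj_rel (delete_vertex G v))\<^sup>*"
    using ncut b b' G(2) unfolding cut_vertex_def connected_graph_def by blast
  then obtain p l where p: "p 0 = b" "p l = b'" "inj_on p {..l}"
    "\<And>i. i < l \<Longrightarrow> (p i, p (Suc i)) \<in> adj_rel (delete_vertex G v)"
    using simple_path_of_reach by metis
  then have pe: "{p i, p (Suc i)} \<in> edges G" "v \<noteq> p i" "v \<noteq> p (Suc i)" if "i < l" for i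
    using that unfolding adj_rel_def delete_vertex_def by auto
  have pv: "p i \<noteq> v" if "i \<le> l" for i
    using pe(2)[of i] that p(2) b' by (cases "i = l") auto
  have pG: "p i \<in> verts G" if "i \<le> l" for i
    using simple_graph_edge_verts[OF G(1) pe(1)[of i]] that p(2) \<open>b' \<in> verts G\<close>
    by (cases "i = l") auto
  define P where "P = {{p i, p (Suc i)} | i. i < l}"
  define H where "H = UGraph (verts B \<union> verts B' \<union> p ` {..l}) (edges B \<union> edges B' \<union> P)"
  have E: "edges B \<subseteq> edges H" "edges B' \<subseteq> edges H" and PH: "\<And>i. i < l \<Longrightarrow> {p i, p (Suc i)} \<in> edges H"
    unfolding H_def P_def by auto
  have VH: "verts H = verts B \<union> verts B' \<union> p ` {..l}" unfolding H_def by simp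
  have HG: "subgraph H G"
  proof -
    have "simple_graph H"
      unfolding simple_graph_def
    proof (intro conjI ballI)
      show "finite (verts H)" using sub unfolding VH subgraph_def simple_graph_def by auto
      fix e assume "e \<in> edges H"
      then consider "e \<in> edges B \<or> e \<in> edges B'" | i where "i < l" "e = {p i, p (Suc i)}"
        unfolding H_def P_def by auto
      then show "\<exists>u\<in>verts H. \<exists>v\<in>verts H. u \<noteq> v \<and> e = {u, v}"
      proof cases
        case 1
        then obtain x y where "x \<in> verts B \<and> y \<in> verts B \<or> x \<in> verts B' \<and> y \<in> verts B'"
          and xy: "x \<noteq> y" "e = {x, y}"
          using sub unfolding subgraph_def simple_graph_def by meson
        then have "x \<in> verts H" "y \<in> verts H" unfolding VH by auto
        then show ?thesis using xy by blast
      next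
        case 2
        then have "p i \<in> verts H" "p (Suc i) \<in> verts H" unfolding VH by auto
        moreover have "p i \<noteq> p (Suc i)" using simple_graph_edge_verts(3)[OF G(1) pe(1)] 2 by blast
        ultimately show ?thesis using 2 by blast
      qed
    qed
    then show ?thesis using sub pG pe(1) unfolding subgraph_def VH by (auto simp: H_def P_def)
  qed
  have blk: "(x, y) \<in> (adj_rel (delete_vertex H z))\<^sup>*"
    if "K = B \<or> K = B'" "x \<in> verts K" "y \<in> verts K" "x \<noteq> z" "y \<noteq> z" for K x y z
  proof (rule reach_delete_mono)
    show "edges K \<subseteq> edges H" using E that by auto
    have K: "nonseparable K" "simple_graph K" using ns sub that unfolding subgraph_def by auto
    show "(x, y) \<in> (adj_rel (delete_vertex K z))\<^sup>*"
    proof (cases "z \<in> verts K")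
      case True
      then show ?thesis
        using K that unfolding nonseparable_def connected_graph_def cut_vertex_def by blast
    next
      case False
      have "(x, y) \<in> (adj_rel K)\<^sup>*"
        using K that unfolding nonseparable_def connected_graph_def by blast
      moreover have "edges K \<subseteq> edges (delete_vertex K z)"
        using False K(2) unfolding delete_vertex_def simple_graph_def by auto
      ultimately show ?thesis by (rule reach_mono)
    qed
  qed
  have arc: "(p i, p j) \<in> (adj_rel (delete_vertex H z))\<^sup>*"
    if "i \<le> j" "j \<le> l" "z \<notin> p ` {i..j}" for i j z
  proof (rule reach_segment)
    fix k assume "i \<le> k" "k < j"
    then show "{p k, p (Suc k)} \<in> edges (delete_vertex H z)"
      using PH[of k] that by (auto simp: delete_vertex_def image_iff)
  qed (use that in simp)
  have to_v: "(x, v) \<in> (adj_rel (delete_vertex H z))\<^sup>*"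
    if x: "x \<in> verts H" "x \<noteq> z" and z: "z \<noteq> v" for x z
  proof -
    consider "x \<in> verts B" | "x \<in> verts B'" | i where "x = p i" "i \<le> l"
      using x unfolding VH by auto
    then show ?thesis
    proof cases
      case 3
      show ?thesis
      proof (cases "z \<in> p ` {0..i}")
        case False
        then have "(p 0, x) \<in> (adj_rel (delete_vertex H z))\<^sup>*" "p 0 \<noteq> z" using arc[of 0 i z] 3 by auto
        then show ?thesis
          using blk[of B "p 0" v z] b v z p(1) by (metis reach_sym rtrancl_trans)
      next
        case True
        then obtain j where j: "z = p j" "j \<le> i" by auto
        then have "j < i" using x 3 by (cases "j = i") auto
        then have "z \<notin> p ` {i..l}" using j p(3) 3 unfolding inj_on_def by fastforce
        then have "(x, p l) \<in> (adj_rel (delete_vertex H z))\<^sup>*" "p l \<noteq> z" using arc[of i l z] 3 by auto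
        then show ?thesis
          using blk[of B' "p l" v z] b' v z p(2) by (metis rtrancl_trans)
      qed
    qed (use blk[of _ x v z] v x z in blast)+
  qed
  have to_b: "(x, b) \<in> (adj_rel (delete_vertex H v))\<^sup>*" if x: "x \<in> verts H" "x \<noteq> v" for x
  proof -
    have pb: "(p i, b) \<in> (adj_rel (delete_vertex H v))\<^sup>*" if "i \<le> l" for i
    proof -
      have "v \<notin> p ` {0..i}"
      proof
        assume "v \<in> p ` {0..i}"
        then obtain k where "k \<le> i" "v = p k" by auto
        then show False using pv[of k] that by simp
      qed
      then have "(p 0, p i) \<in> (adj_rel (delete_vertex H v))\<^sup>*" using arc[of 0 i v] that by blast
      then show ?thesis unfolding p(1) by (rule reach_sym)
    qed
    consider "x \<in> verts B" | "x \<in> verts B'" | i where "x = p i" "i \<le> l"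
      using x unfolding VH by auto
    then show ?thesis
    proof cases
      case 1
      then show ?thesis using blk[of B x b v] b x by blast
    next
      case 2
      then have "(x, b') \<in> (adj_rel (delete_vertex H v))\<^sup>*" using blk[of B' x b' v] b' x by blast
      then show ?thesis using pb[of l] p(2) by (metis order_refl rtrancl_trans)
    next
      case 3
      then show ?thesis using pb by blast
    qed
  qed
  have "nonseparable H"
  proof (rule nonseparableI_roots[of v])
    show "v \<in> verts H" using v unfolding VH by simp
    show "\<exists>r. \<forall>x\<in>verts H - {z}. (x, r) \<in> (adj_rel (delete_vertex H z))\<^sup>*" for z
      using to_v to_b by (intro exI[of _ "if z = v then b else v"]) simp
    have del: "edges (delete_vertex H z) \<subseteq> edges H" for z unfolding delete_vertex_def by auto
    show "(x, v) \<in> (adj_rel H)\<^sup>*" if x: "x \<in> verts H" for x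
    proof (cases "x = b")
      case True
      have "(b, v) \<in> (adj_rel B)\<^sup>*"
        using ns(1) b v unfolding nonseparable_def connected_graph_def by blast
      then show ?thesis using reach_mono E(1) True by metis
    next
      case False
      then show ?thesis using to_v[of x b] x b(2) by (intro reach_mono[OF _ del]) auto
    qed
  qed
  moreover have "subgraph B H" "subgraph B' H" using sub E unfolding subgraph_def VH by auto
  ultimately have "H = B" "H = B'" using block_maximal B(1,2) HG by blast+
  then show False using B(3) by simp
qed

section \<open>From the block-cutpoint path to a rooted snake\<close>

text \<open>The isomorphism \<open>\<phi>\<close> gives each block and each cut vertex its position on the path, and blocks
alternate with cut vertices.\<close>

locale block_cutpoint_path =
  fixes G :: "'a ugraph" and \<phi> :: "'a ugraph + 'a \<Rightarrow> nat" and p t :: nat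
  assumes simple: "simple_graph G" and conn: "connected_graph G"
    and cycles: "\<And>B. is_block G B \<Longrightarrow> is_cycle t B"
    and pos_bij: "bij_betw \<phi> (verts (block_cutpoint_graph G)) {..<p}"
    and pos_edges: "edges (path_graph p) = (\<lambda>e. \<phi> ` e) ` edges (block_cutpoint_graph G)"
begin

lemma nodes: "verts (block_cutpoint_graph G) = Inl ` {B. is_block G B} \<union> Inr ` {v. cut_vertex G v}"
  by (simp add: block_cutpoint_graph_def)

lemma pos_inj: "inj_on \<phi> (Inl ` {B. is_block G B} \<union> Inr ` {v. cut_vertex G v})"
  using pos_bij unfolding nodes bij_betw_def by simp

lemma pos_block_less: "is_block G B \<Longrightarrow> \<phi> (Inl B) < p"
  using pos_bij unfolding nodes bij_betw_def by auto

lemma pos_block_eq: "is_block G B \<Longrightarrow> is_block G B' \<Longrightarrow> \<phi> (Inl B) = \<phi> (Inl B') \<Longrightarrow> B = B'"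
  using pos_inj unfolding inj_on_def by blast

lemma pos_cut_eq: "cut_vertex G v \<Longrightarrow> cut_vertex G v' \<Longrightarrow> \<phi> (Inr v) = \<phi> (Inr v') \<Longrightarrow> v = v'"
  using pos_inj unfolding inj_on_def by blast

lemma pos_block_neq_cut: "is_block G B \<Longrightarrow> cut_vertex G v \<Longrightarrow> \<phi> (Inl B) \<noteq> \<phi> (Inr v)"
  using pos_inj unfolding inj_on_def by blast

lemma incident_pos:
  assumes "is_block G B" "cut_vertex G v" "v \<in> verts B"
  shows "\<phi> (Inr v) = Suc (\<phi> (Inl B)) \<or> \<phi> (Inl B) = Suc (\<phi> (Inr v))"
proof -
  have "{Inl B, Inr v} \<in> edges (block_cutpoint_graph G)"
    using assms unfolding block_cutpoint_graph_def by auto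
  then have "\<phi> ` {Inl B, Inr v} \<in> edges (path_graph p)" unfolding pos_edges by blast
  then show ?thesis unfolding path_graph_def by (auto simp: doubleton_eq_iff)
qed

lemma consecutive_incident:
  assumes "Suc i < p"
  obtains B v where "is_block G B" "cut_vertex G v" "v \<in> verts B"
    "\<phi> (Inl B) = i \<and> \<phi> (Inr v) = Suc i \<or> \<phi> (Inl B) = Suc i \<and> \<phi> (Inr v) = i"
proof -
  have "{i, Suc i} \<in> edges (path_graph p)" using assms unfolding path_graph_def by auto
  then obtain e where "{i, Suc i} = \<phi> ` e" "e \<in> edges (block_cutpoint_graph G)"
    unfolding pos_edges by blast
  then obtain B v where "is_block G B" "cut_vertex G v" "v \<in> verts B"
    "{i, Suc i} = {\<phi> (Inl B), \<phi> (Inr v)}"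
    unfolding block_cutpoint_graph_def by auto
  then show thesis using that by (auto simp: doubleton_eq_iff)
qed

lemma cut_after_block:
  assumes "is_block G B" "Suc (\<phi> (Inl B)) < p"
  obtains c where "cut_vertex G c" "c \<in> verts B" "\<phi> (Inr c) = Suc (\<phi> (Inl B))"
  using consecutive_incident[OF assms(2)] pos_block_eq pos_block_neq_cut assms(1) by metis

lemma block_after_cut:
  assumes "cut_vertex G c" "Suc (\<phi> (Inr c)) < p"
  obtains B where "is_block G B" "c \<in> verts B" "\<phi> (Inl B) = Suc (\<phi> (Inr c))"
  using consecutive_incident[OF assms(2)] pos_cut_eq pos_block_neq_cut assms(1) by metis

text \<open>The blocks not before position \<open>i\<close>; together they form a tail of the snake, which is grown before the
blocks in front of it.\<close>

definition from_pos :: "nat \<Rightarrow> 'a ugraph set" where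
  "from_pos i = {B. is_block G B \<and> i \<le> \<phi> (Inl B)}"

lemma finite_from_pos: "finite (from_pos i)"
proof -
  have "finite (Inl ` {B. is_block G B} \<union> Inr ` {v. cut_vertex G v})"
    using pos_bij unfolding nodes using bij_betw_finite by blast
  then have "finite {B. is_block G B}" by (auto dest: finite_imageD)
  then show ?thesis unfolding from_pos_def by (rule finite_subset[rotated]) auto
qed

text \<open>The position following a block is taken by a cut vertex or lies beyond the end of the path, so the
next block comes two positions later.\<close>

lemma from_pos_block:
  assumes "is_block G B"
  shows "from_pos (\<phi> (Inl B)) = insert B (from_pos (\<phi> (Inl B) + 2))"
proof -
  have "\<phi> (Inl B') \<noteq> Suc (\<phi> (Inl B))" if B': "is_block G B'" for B'
  proof
    assume eq: "\<phi> (Inl B') = Suc (\<phi> (Inl B))"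
    then have "Suc (\<phi> (Inl B)) < p" using pos_block_less[OF B'] by simp
    then show False using cut_after_block[OF assms] pos_block_neq_cut[OF B'] eq by metis
  qed
  then have "i = \<phi> (Inl B) \<or> \<phi> (Inl B) + 2 \<le> i"
    if "is_block G B'" "\<phi> (Inl B') = i" "\<phi> (Inl B) \<le> i" for i B'
    using that by (metis add_2_eq_Suc' le_eq_less_or_eq less_eq_Suc_le)
  then show ?thesis using assms pos_block_eq unfolding from_pos_def by fastforce
qed

definition tail_graph :: "nat \<Rightarrow> 'a ugraph" where
  "tail_graph i = UGraph (\<Union>B\<in>from_pos i. verts B) (\<Union>B\<in>from_pos i. edges B)"

text \<open>A vertex shared by the block at position \<open>i\<close> and a later one is a cut vertex at a position adjacent
to both, which can only be \<open>i + 1\<close>. Hence the block meets the later part of the snake exactly in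
the cut vertex \<open>c\<close> at that position. The third assumption says that the root is not \<open>c\<close>; it reappears
for the next block because \<open>c\<close> itself is the root there and its position is before that block.\<close>

lemma tail_rooted_snake:
  assumes "is_block G B" "v \<in> verts B" "\<not> (cut_vertex G v \<and> \<phi> (Inr v) = Suc (\<phi> (Inl B)))"
  shows "rooted_snake t (card (from_pos (\<phi> (Inl B)))) v (tail_graph (\<phi> (Inl B)))"
  using assms
proof (induction "p - \<phi> (Inl B)" arbitrary: B v rule: less_induct)
  case less
  note B = less.prems(1)
  let ?i = "\<phi> (Inl B)"
  have X: "from_pos ?i = insert B (from_pos (?i + 2))" by (rule from_pos_block[OF B])
  show ?case
  proof (cases "?i + 2 < p")
    case False
    have "\<not> ?i + 2 \<le> \<phi> (Inl K)" if "is_block G K" for K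
      using pos_block_less[OF that] False by linarith
    then have "from_pos (?i + 2) = {}" unfolding from_pos_def by blast
    then have "card (from_pos ?i) = 1" "tail_graph ?i = B"
      unfolding X tail_graph_def by simp_all
    then show ?thesis using single[OF cycles[OF B] less.prems(2)] by simp
  next
    case True
    obtain c where c: "cut_vertex G c" "c \<in> verts B" "\<phi> (Inr c) = Suc ?i"
      using cut_after_block[OF B] True by auto
    obtain B' where B': "is_block G B'" "c \<in> verts B'" "\<phi> (Inl B') = ?i + 2"
      using block_after_cut[OF c(1)] True c(3) by auto
    have IH: "rooted_snake t (card (from_pos (?i + 2))) c (tail_graph (?i + 2))"
      using less.hyps[of B' c] B' c True by auto
    have "x = c" if x: "x \<in> verts B" "K \<in> from_pos (?i + 2)" "x \<in> verts K" for x K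
    proof -
      have K: "is_block G K" "?i + 2 \<le> \<phi> (Inl K)" using x unfolding from_pos_def by auto
      have "B \<noteq> K" using K(2) by auto
      with B K(1) x(1,3) have cut: "cut_vertex G x"
        by (intro shared_vertex_is_cut[OF simple conn])
      have "\<phi> (Inr x) = Suc ?i"
        using incident_pos[OF B cut x(1)] incident_pos[OF K(1) cut x(3)] K(2) by linarith
      then show ?thesis using pos_cut_eq[OF cut c(1)] c(3) by simp
    qed
    then have "verts B \<inter> verts (tail_graph (?i + 2)) \<subseteq> {c}"
      unfolding tail_graph_def ugraph.sel by blast
    moreover have "B' \<in> from_pos (?i + 2)" using B' unfolding from_pos_def by simp
    then have "c \<in> verts (tail_graph (?i + 2))"
      using B'(2) unfolding tail_graph_def ugraph.sel by blast
    ultimately have I: "verts B \<inter> verts (tail_graph (?i + 2)) = {c}" using c(2) by blast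
    have "v \<noteq> c" using less.prems(3) c by auto
    note attach[OF cycles[OF B] less.prems(2) c(2) this IH I]
    moreover have "card (from_pos ?i) = Suc (card (from_pos (?i + 2)))"
      unfolding X using finite_from_pos by (subst card_insert_disjoint) (auto simp: from_pos_def)
    moreover have "tail_graph ?i = graph_union B (tail_graph (?i + 2))"
      unfolding tail_graph_def graph_union_def X by simp
    ultimately show ?thesis by simp
  qed
qed

lemma ex_rooted_snake:
  assumes "{B. is_block G B} \<noteq> {}"
  shows "\<exists>v. rooted_snake t (card {B. is_block G B}) v G"
proof -
  \<comment> \<open>The path may begin with a block or with a cut vertex; starting from the first block covers both.\<close>
  obtain K where "is_block G K" using assms by blast
  from ex_has_least_nat[of "is_block G", OF this, of "\<lambda>B. \<phi> (Inl B)"]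
  obtain B where B: "is_block G B" and least: "\<And>K. is_block G K \<Longrightarrow> \<phi> (Inl B) \<le> \<phi> (Inl K)"
    by blast
  have all: "from_pos (\<phi> (Inl B)) = {B. is_block G B}" using least unfolding from_pos_def by blast
  have whole: "tail_graph (\<phi> (Inl B)) = G"
  proof -
    have sub: "verts K \<subseteq> verts G" "edges K \<subseteq> edges G" if "is_block G K" for K
      using block_subgraph[OF that] unfolding subgraph_def by auto
    have "(\<Union>K\<in>{B. is_block G B}. verts K) = verts G"
      using sub(1) by (auto elim: vertex_in_block[OF simple])
    moreover have "(\<Union>K\<in>{B. is_block G B}. edges K) = edges G"
      using sub(2) by (auto elim: edge_in_block[OF simple])
    ultimately show ?thesis unfolding tail_graph_def all by simp
  qed
  obtain v where v: "v \<in> verts B" "\<not> (cut_vertex G v \<and> \<phi> (Inr v) = Suc (\<phi> (Inl B)))"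
  proof -
    obtain x y where xy: "x \<in> verts B" "y \<in> verts B" "x \<noteq> y"
      using cycle_two_vertices[OF cycles[OF B]] .
    show thesis
    proof (cases "cut_vertex G x \<and> \<phi> (Inr x) = Suc (\<phi> (Inl B))")
      case True
      then have "\<not> (cut_vertex G y \<and> \<phi> (Inr y) = Suc (\<phi> (Inl B)))"
        using pos_cut_eq[of x y] xy(3) by auto
      then show thesis using that xy(2) by blast
    next
      case False
      then show thesis using that xy(1) by blast
    qed
  qed
  show ?thesis using tail_rooted_snake[OF B v] unfolding all whole by blast
qed

end

lemma cyclic_snake_rooted:
  assumes "cyclic_snake k t G" "k \<ge> 1"
  shows "\<exists>v. rooted_snake t k v G"
proof -
  have snake: "simple_graph G" "connected_graph G" "card {B. is_block G B} = k"
    "\<And>B. is_block G B \<Longrightarrow> is_cycle t B" "is_path (block_cutpoint_graph G)"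
    using assms(1) unfolding cyclic_snake_def by blast+
  obtain p \<phi> where \<phi>: "bij_betw \<phi> (verts (block_cutpoint_graph G)) (verts (path_graph p))"
    "edges (path_graph p) = (\<lambda>e. \<phi> ` e) ` edges (block_cutpoint_graph G)"
    using snake(5) unfolding is_path_def graph_iso_def by blast
  have "verts (path_graph p) = {..<p}" unfolding path_graph_def by simp
  with snake \<phi> interpret block_cutpoint_path G \<phi> p t
    by unfold_locales simp_all
  have "{B. is_block G B} \<noteq> {}"
  proof
    assume "{B. is_block G B} = {}"
    then show False using snake(3) assms(2) by simp
  qed
  then show ?thesis using ex_rooted_snake unfolding snake(3) by blast
qed

section \<open>Graceful labellings of all snakes\<close>

theorem theorem2p1:
  fixes n :: nat
  assumes "n \<ge> 1"
    and "\<And>s::nat. s \<ge> 1 \<Longrightarrow>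
      \<exists>U :: (nat ugraph \<times> (nat \<Rightarrow> int) \<times> nat) set. complete_useful_cycle_set s (4 * n) U"
  shows "\<forall>k\<ge>1. \<forall>G :: 'a ugraph. cyclic_snake k (4 * n) G \<longrightarrow> (\<exists>f. graceful_labelling G f)"
proof (intro allI impI)
  fix k :: nat and G :: "'a ugraph"
  assume "k \<ge> 1" "cyclic_snake k (4 * n) G"
  then obtain v where G: "rooted_snake (4 * n) k v G" using cyclic_snake_rooted by blast
  then obtain f where f: "inj_on f (verts G)" "f ` verts G \<subseteq> {0..int k * int (4 * n)}"
    "induced_edge_labels G f = {1..int k * int (4 * n)}"
    using rooted_snake_labelling[OF G assms(2)] by blast
  show "\<exists>f. graceful_labelling G f"
    using graceful_labelling_by_counting[of G f "k * (4 * n)"] rooted_snake_edge_bound[OF G] f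
    by (intro exI[of _ f]) simp
qed

end
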